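(* Consider the uncertain control affine system \[ \dot x = f(x) + g(x)u + \varphi(x,u)\theta,\qquad \varphi(x,u)=[F(x)\;\; G(x)\,\mathrm{diag}(u)]\in\mathbb{R}^{n\times(p+m)}, \] with state $x\in\mathbb{R}^n$, input $u\in\mathcal{U}\subseteq\mathbb{R}^m$, known locally Lipschitz $f,g$, known $F:\mathbb{R}^n\to\mathbb{R}^{n\times p}$, $G:\mathbb{R}^n\to\mathbb{R}^{n\times m}$, and unknown $\theta\in\mathbb{R}^{p+m}$ lying in a known hyperrectangle $\Theta=[\underline{\theta}_1,\overline{\theta}_1]\times\cdots\times[\underline{\theta}_{p+m},\overline{\theta}_{p+m}]$, written as $\Theta=\{\theta: A\theta\le b\}$ with $A\in\mathbb{R}^{2(p+m)\times(p+m)}$, $b\in\mathbb{R}^{2(p+m)}$. Assume $f(0)=0$ and $\varphi(0,0)=0$. Let $V:\mathbb{R}^n\to\mathbb{R}_{\ge0}$ be continuously differentiable and positive definite, $\mathcal{D}\subseteq\mathbb{R}^n$ contain the origin, and suppose there is a class $\mathcal{K}$ function $\gamma$ with \[ \inf_{u\in\mathcal{U}}\sup_{\theta\in\Theta}\big(L_fV(x)+L_gV(x)u+L_\varphi V(x,u)\theta\big)\le-\gamma(V(x))\quad\forall x\in\mathcal{D}, \] and that for each $x\in\mathcal{D}$ the set $K_{rclf}(x)=\{u\in\mathcal{U}\mid L_fV(x)+L_gV(x)u+\sup_{\theta\in\Theta}L_\varphi V(x,u)\theta\le-\gamma(V(x))\}$ is nonempty. For each $x$ consider the quadratic program in $u\in\mathcal{U}$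 and $\lambda\in\mathbb{R}^{2(p+m)}$: \[ \min_{u\in\mathcal{U},\,\lambda\ge0}\ \tfrac12\|u\|^2\quad\text{s.t.}\quad L_fV(x)+L_gV(x)u+b^\top\lambda\le-\gamma(V(x)),\qquad \lambda^\top A=L_\varphi V(x,u). \] Then any locally Lipschitz policy $u=k(x)$ given by (the $u$-component of) a solution of this program renders the origin asymptotically stable for the closed-loop system.
   Context: $L_fV(x)=\nabla V(x)f(x)$, $L_gV(x)=\nabla V(x)g(x)$, $L_\varphi V(x,u)=\nabla V(x)\varphi(x,u)\in\mathbb{R}^{1\times(p+m)}$. $\lambda\ge0$ is componentwise. A class $\mathcal{K}$ function is a continuous strictly increasing $\gamma:[0,\infty)\to[0,\infty)$ with $\gamma(0)=0$. *)

theory Defs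
  imports "HOL-Analysis.Analysis"
begin

definition loc_lipschitz_on :: "'a::metric_space set \<Rightarrow> ('a \<Rightarrow> 'b::metric_space) \<Rightarrow> bool" where
  "loc_lipschitz_on S h \<longleftrightarrow>
     (\<forall>x\<in>S. \<exists>e>0. \<exists>L. \<forall>y\<in>ball x e. \<forall>z\<in>ball x e. dist (h y) (h z) \<le> L * dist y z)"

definition class_K :: "(real \<Rightarrow> real) \<Rightarrow> bool" where
  "class_K \<gamma> \<longleftrightarrow> continuous_on {0..} \<gamma> \<and> strict_mono_on {0..} \<gamma> \<and> \<gamma> 0 = 0
                 \<and> (\<forall>s\<ge>0. \<gamma> s \<ge> 0)"

definition pos_def :: "('a::real_vector \<Rightarrow> real) \<Rightarrow> bool" where
  "pos_def V \<longleftrightarrow> V 0 = 0 \<and> (\<forall>x. x \<noteq> 0 \<longrightarrow> V x > 0)"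

text \<open>The regressor \<open>\<phi>(x,u) = [F(x)  G(x) diag(u)]\<close>, columns indexed by \<open>'p + 'm\<close>.\<close>
definition phi :: "(real^'n::finite \<Rightarrow> real^'p::finite^'n) \<Rightarrow> (real^'n \<Rightarrow> real^'m::finite^'n)
                    \<Rightarrow> real^'n \<Rightarrow> real^'m \<Rightarrow> real^('p + 'm)^'n" where
  "phi F G x u = (\<chi> i. \<chi> j. (case j of Inl a \<Rightarrow> F x $ i $ a | Inr c \<Rightarrow> G x $ i $ c * u $ c))"

definition is_sol :: "('a::real_normed_vector \<Rightarrow> 'a) \<Rightarrow> (real \<Rightarrow> 'a) \<Rightarrow> real set \<Rightarrow> bool" where
  "is_sol h x I \<longleftrightarrow> (\<forall>t\<in>I. (x has_vector_derivative h (x t)) (at t within I))"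

definition asymp_stable :: "('a::real_normed_vector \<Rightarrow> 'a) \<Rightarrow> bool" where
  "asymp_stable h \<longleftrightarrow>
     (\<forall>\<epsilon>>0. \<exists>\<delta>>0. \<forall>x T. T \<ge> 0 \<and> is_sol h x {0..T} \<and> norm (x 0) < \<delta>
                       \<longrightarrow> (\<forall>t\<in>{0..T}. norm (x t) < \<epsilon>))
   \<and> (\<exists>\<eta>>0. \<forall>x. is_sol h x {0..} \<and> norm (x 0) < \<eta> \<longrightarrow> (x \<longlongrightarrow> 0) at_top)"

end

theory Submission
  imports Defs
begin

text \<open>The constraints of the quadratic program are a dual certificate: if \<open>\<lambda> \<ge> 0\<close> and
  \<open>\<lambda>\<^sup>T A = L\<^sub>\<phi>V(x, k x)\<close>, then weak LP duality gives \<open>L\<^sub>\<phi>V(x, k x) \<theta> \<le> b\<^sup>T \<lambda>\<close> for every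
  \<open>\<theta>\<close> with \<open>A \<theta> \<le> b\<close>, so along the closed loop \<open>V' \<le> -\<gamma>(V)\<close> on \<open>D\<close> whatever the true
  parameter is. Then \<open>V\<close> is a strict Lyapunov function near the origin. Stability: a solution
  starting where \<open>V\<close> is small cannot reach a sphere on which \<open>V\<close> is bounded below, because
  \<open>V\<close> does not increase before it gets there. Attractivity: while \<open>V \<ge> e\<close>, \<open>V\<close> decreases at
  rate at least \<open>\<gamma>(e)\<close>, so \<open>V(x t) \<rightarrow> 0\<close>, which forces \<open>x t \<rightarrow> 0\<close> on a bounded set.\<close>

lemma is_sol_subset: "is_sol h x I \<Longrightarrow> J \<subseteq> I \<Longrightarrow> is_sol h x J"
  unfolding is_sol_def by (meson has_vector_derivative_within_subset subsetD)

lemma is_sol_continuous_on: "is_sol h x I \<Longrightarrow> continuous_on I x"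
  unfolding is_sol_def
  by (meson continuous_on_eq_continuous_within has_vector_derivative_continuous)

lemma has_real_derivative_compose_path:
  fixes V :: "'a::real_normed_vector \<Rightarrow> real"
  assumes V: "(V has_derivative V') (at (x t))"
    and x: "(x has_vector_derivative x') (at t within I)"
  shows "((\<lambda>s. V (x s)) has_real_derivative V' x') (at t within I)"
proof -
  have "((\<lambda>s. V (x s)) has_derivative (\<lambda>s. V' (s *\<^sub>R x'))) (at t within I)"
    using has_derivative_compose[OF x[unfolded has_vector_derivative_def] V] .
  moreover have "(\<lambda>s. V' (s *\<^sub>R x')) = (*) (V' x')"
    using has_derivative_linear[OF V] by (simp add: fun_eq_iff linear_scale)
  ultimately show ?thesis
    by (simp add: has_field_derivative_def)
qed

lemma is_sol_increment_le:
  fixes H :: "'a::real_normed_vector \<Rightarrow> 'a" and V :: "'a \<Rightarrow> real"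
  assumes V_deriv: "\<And>y. (V has_derivative DV y) (at y)"
    and sol: "is_sol H x {a..b}" and "a \<le> b"
    and bound: "\<And>t. a < t \<Longrightarrow> t < b \<Longrightarrow> DV (x t) (H (x t)) \<le> K"
  shows "V (x b) - V (x a) \<le> K * (b - a)"
proof -
  have "(\<lambda>t. V (x t) - K * t) b \<le> (\<lambda>t. V (x t) - K * t) a"
  proof (rule DERIV_nonpos_imp_decreasing_open[OF \<open>a \<le> b\<close>])
    fix t assume t: "a < t" "t < b"
    have "(x has_vector_derivative H (x t)) (at t within {a..b})"
      using sol t unfolding is_sol_def by simp
    then have "(x has_vector_derivative H (x t)) (at t)"
      by (simp add: at_within_Icc_at t)
    then have "((\<lambda>t. V (x t)) has_real_derivative DV (x t) (H (x t))) (at t)"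
      by (rule has_real_derivative_compose_path[OF V_deriv])
    from DERIV_diff[OF this DERIV_cmult_Id[of K]]
    have "((\<lambda>t. V (x t) - K * t) has_real_derivative DV (x t) (H (x t)) - K) (at t)" .
    then show "\<exists>y. ((\<lambda>t. V (x t) - K * t) has_real_derivative y) (at t) \<and> y \<le> 0"
      using bound[OF t] by (intro exI[of _ "DV (x t) (H (x t)) - K"]) simp
  next
    have "continuous_on UNIV V"
      using V_deriv by (meson continuous_at_imp_continuous_on has_derivative_continuous)
    then have "continuous_on {a..b} (\<lambda>t. V (x t))"
      using continuous_on_compose2[OF _ is_sol_continuous_on[OF sol]] by blast
    then show "continuous_on {a..b} (\<lambda>t. V (x t) - K * t)"
      by (intro continuous_intros)
  qed
  then show ?thesis
    by (simp add: algebra_simps)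
qed

lemma first_hitting_time:
  fixes c :: "real \<Rightarrow> real"
  assumes c: "continuous_on {a..b} c" and "c a < e" and t: "t \<in> {a..b}" "e \<le> c t"
  obtains s where "s \<in> {a..b}" "c s = e" "\<And>\<tau>. a \<le> \<tau> \<Longrightarrow> \<tau> < s \<Longrightarrow> c \<tau> < e"
proof -
  define Z where "Z = {a..b} \<inter> c -` {e..}"
  have "closed Z"
    unfolding Z_def using continuous_closed_preimage[OF c closed_atLeastAtMost closed_atLeast] .
  then have "compact Z"
    using closed_Int_compact[OF _ compact_Icc, of Z a b] by (simp add: Z_def Int_absorb2)
  moreover have "t \<in> Z"
    using t by (simp add: Z_def)
  ultimately obtain s where "s \<in> Z" and min: "\<And>\<tau>. \<tau> \<in> Z \<Longrightarrow> s \<le> \<tau>"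
    using compact_attains_inf[of Z] by blast
  then have "a \<le> s" "s \<le> b" "e \<le> c s"
    by (auto simp: Z_def)
  moreover have "continuous_on {a..s} c"
    by (rule continuous_on_subset[OF c]) (use \<open>s \<le> b\<close> in auto)
  ultimately obtain s' where "a \<le> s'" "s' \<le> s" "c s' = e"
    using IVT'[of c a e s] \<open>c a < e\<close> by force
  then have "s' \<in> Z"
    using \<open>s \<le> b\<close> by (simp add: Z_def)
  then have "c s = e"
    using min[of s'] \<open>s' \<le> s\<close> \<open>c s' = e\<close> by simp
  moreover have "c \<tau> < e" if "a \<le> \<tau>" "\<tau> < s" for \<tau>
  proof (rule ccontr)
    assume "\<not> c \<tau> < e"
    then have "\<tau> \<in> Z"
      using that \<open>s \<le> b\<close> by (simp add: Z_def)
    then show False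
      using min[of \<tau>] \<open>\<tau> < s\<close> by simp
  qed
  ultimately show ?thesis
    using that \<open>a \<le> s\<close> \<open>s \<le> b\<close> by simp
qed

lemma pos_def_bounded_below_on_annulus:
  fixes V :: "'a::{real_normed_vector, heine_borel} \<Rightarrow> real"
  assumes "continuous_on UNIV V" "pos_def V" "0 < a"
  obtains m where "0 < m" "\<And>y. a \<le> norm y \<Longrightarrow> norm y \<le> c \<Longrightarrow> m \<le> V y"
proof -
  let ?S = "cball (0::'a) c - ball 0 a"
  show ?thesis
  proof (cases "?S = {}")
    case True
    show ?thesis
    proof (rule that[of 1])
      fix y :: 'a assume "a \<le> norm y" "norm y \<le> c"
      then have "y \<in> ?S"
        by simp
      with True show "1 \<le> V y"
        by blast
    qed simp
  next
    case False
    have "compact ?S"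
      by (simp add: compact_diff)
    then obtain y0 where y0: "y0 \<in> ?S" "\<And>y. y \<in> ?S \<Longrightarrow> V y0 \<le> V y"
      using continuous_attains_inf[OF _ False continuous_on_subset[OF assms(1)]] by blast
    have "y0 \<noteq> 0"
      using y0(1) assms(3) by auto
    then have "0 < V y0"
      using assms(2) by (simp add: pos_def_def)
    show ?thesis
      by (rule that[OF \<open>0 < V y0\<close>]) (simp add: y0(2))
  qed
qed

lemma tendsto_zero_of_pos_def:
  fixes x :: "'b \<Rightarrow> 'a::{real_normed_vector, heine_borel}"
  assumes "continuous_on UNIV V" "pos_def V"
    and bounded: "eventually (\<lambda>t. norm (x t) \<le> r) F"
    and V_lim: "((\<lambda>t. V (x t)) \<longlongrightarrow> 0) F"
  shows "(x \<longlongrightarrow> 0) F"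
proof (rule tendstoI)
  fix e :: real assume "0 < e"
  then obtain m where "0 < m" and m: "\<And>y. e \<le> norm y \<Longrightarrow> norm y \<le> r \<Longrightarrow> m \<le> V y"
    using pos_def_bounded_below_on_annulus[OF assms(1,2)] by blast
  have "eventually (\<lambda>t. V (x t) < m) F"
    using order_tendstoD(2)[OF V_lim \<open>0 < m\<close>] .
  with bounded show "eventually (\<lambda>t. dist (x t) 0 < e) F"
    by eventually_elim (use m in force)
qed

locale strict_lyapunov =
  fixes H :: "'a::{real_normed_vector, heine_borel} \<Rightarrow> 'a" and V :: "'a \<Rightarrow> real" and DV :: "'a \<Rightarrow> 'a \<Rightarrow> real"
    and D :: "'a set" and \<alpha> :: "real \<Rightarrow> real"
  assumes V_deriv: "\<And>y. (V has_derivative DV y) (at y)"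
    and V_pos_def: "pos_def V"
    and D_open: "open D" and D0: "0 \<in> D"
    and \<alpha>_class_K: "class_K \<alpha>"
    and decrease: "\<And>y. y \<in> D \<Longrightarrow> DV y (H y) \<le> - \<alpha> (V y)"
begin

lemma V_continuous: "continuous_on UNIV V"
  using V_deriv by (meson continuous_at_imp_continuous_on has_derivative_continuous)

lemma V_zero: "V 0 = 0"
  using V_pos_def by (simp add: pos_def_def)

lemma V_nonneg: "0 \<le> V y"
  using V_pos_def by (cases "y = 0") (auto simp: pos_def_def less_imp_le)

lemma \<alpha>_mono: "0 \<le> s \<Longrightarrow> s \<le> s' \<Longrightarrow> \<alpha> s \<le> \<alpha> s'"
  using \<alpha>_class_K strict_mono_on_leD[of "{0..}" \<alpha> s s'] by (simp add: class_K_def)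

lemma \<alpha>_pos: "0 < s \<Longrightarrow> 0 < \<alpha> s"
  using \<alpha>_class_K strict_mono_onD[of "{0..}" \<alpha> 0 s] by (simp add: class_K_def)

lemma decrease_nonpos: "y \<in> D \<Longrightarrow> DV y (H y) \<le> 0"
  using decrease[of y] \<alpha>_mono[OF order_refl V_nonneg[of y]] \<alpha>_class_K
  by (simp add: class_K_def)

lemma V_antimono_along_sol:
  assumes sol: "is_sol H x {a..b}" and "a \<le> b" and in_D: "\<And>t. a < t \<Longrightarrow> t < b \<Longrightarrow> x t \<in> D"
  shows "V (x b) \<le> V (x a)"
proof -
  have "V (x b) - V (x a) \<le> 0 * (b - a)"
    by (rule is_sol_increment_le[OF V_deriv sol \<open>a \<le> b\<close>]) (use in_D decrease_nonpos in blast)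
  then show ?thesis
    by simp
qed

lemma V_below_level:
  assumes sol: "is_sol H x {0..T}" and in_D: "\<And>t. 0 < t \<Longrightarrow> t < T \<Longrightarrow> x t \<in> D"
    and "0 < e" and horizon: "V (x 0) < \<alpha> e * T"
  shows "V (x T) < e"
proof (rule ccontr)
  assume "\<not> V (x T) < e"
  have "0 < \<alpha> e"
    using \<alpha>_pos[OF \<open>0 < e\<close>] .
  have "0 < \<alpha> e * T"
    using V_nonneg horizon by (rule le_less_trans)
  then have "0 \<le> T"
    using \<open>0 < \<alpha> e\<close> by (simp add: zero_less_mult_iff)
  have large: "e \<le> V (x s)" if "0 \<le> s" "s \<le> T" for s
  proof -
    have "V (x T) \<le> V (x s)"
    proof (rule V_antimono_along_sol[OF is_sol_subset[OF sol]])
      show "x t \<in> D" if "s < t" "t < T" for t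
        using in_D \<open>0 \<le> s\<close> that by simp
    qed (use that in auto)
    with \<open>\<not> V (x T) < e\<close> show ?thesis
      by simp
  qed
  have "V (x T) - V (x 0) \<le> - \<alpha> e * (T - 0)"
  proof (rule is_sol_increment_le[OF V_deriv sol \<open>0 \<le> T\<close>])
    fix s assume "0 < s" "s < T"
    then have "\<alpha> e \<le> \<alpha> (V (x s))"
      using \<alpha>_mono large[of s] \<open>0 < e\<close> by simp
    moreover have "DV (x s) (H (x s)) \<le> - \<alpha> (V (x s))"
      using decrease in_D \<open>0 < s\<close> \<open>s < T\<close> by blast
    ultimately show "DV (x s) (H (x s)) \<le> - \<alpha> e"
      by simp
  qed
  then show False
    using horizon V_nonneg[of "x T"] by simp
qed

lemma stays_in_ball:
  assumes "0 < \<epsilon>" "cball 0 \<epsilon> \<subseteq> D"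
  obtains \<delta> where "0 < \<delta>"
    "\<And>x T t. is_sol H x {0..T} \<Longrightarrow> norm (x 0) < \<delta> \<Longrightarrow> t \<in> {0..T} \<Longrightarrow> norm (x t) < \<epsilon>"
proof -
  obtain m where "0 < m" and m: "\<And>y. \<epsilon> \<le> norm y \<Longrightarrow> norm y \<le> \<epsilon> \<Longrightarrow> m \<le> V y"
    using pos_def_bounded_below_on_annulus[OF V_continuous V_pos_def \<open>0 < \<epsilon>\<close>] by blast
  obtain d where "0 < d" and d: "\<And>y. dist y 0 < d \<Longrightarrow> dist (V y) (V 0) < m"
    using V_continuous \<open>0 < m\<close> unfolding continuous_on_iff by blast
  have V_small: "V y < m" if "norm y < d" for y
    using d[of y] that V_zero V_nonneg[of y] by simp
  have "norm (x t) < \<epsilon>"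
    if sol: "is_sol H x {0..T}" and x0: "norm (x 0) < min d \<epsilon>" and t: "t \<in> {0..T}" for x T t
  proof (rule ccontr)
    assume "\<not> norm (x t) < \<epsilon>"
    moreover have "continuous_on {0..T} (\<lambda>t. norm (x t))"
      by (intro continuous_intros is_sol_continuous_on[OF sol])
    moreover have "norm (x 0) < \<epsilon>"
      using x0 by simp
    ultimately obtain s where s: "s \<in> {0..T}" "norm (x s) = \<epsilon>"
      and before: "\<And>\<tau>. 0 \<le> \<tau> \<Longrightarrow> \<tau> < s \<Longrightarrow> norm (x \<tau>) < \<epsilon>"
      using first_hitting_time[of 0 T "\<lambda>t. norm (x t)" \<epsilon> t] t by (auto simp: not_less)
    have "V (x s) \<le> V (x 0)"
    proof (rule V_antimono_along_sol[OF is_sol_subset[OF sol]])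
      fix \<tau> assume "0 < \<tau>" "\<tau> < s"
      then have "x \<tau> \<in> cball 0 \<epsilon>"
        using before[of \<tau>] by simp
      then show "x \<tau> \<in> D"
        using assms(2) by blast
    qed (use s in auto)
    moreover have "V (x 0) < m"
      using V_small x0 by simp
    ultimately show False
      using m[of "x s"] s(2) by simp
  qed
  then show ?thesis
    using that[of "min d \<epsilon>"] \<open>0 < d\<close> \<open>0 < \<epsilon>\<close> by simp
qed

lemma stable:
  "\<forall>\<epsilon>>0. \<exists>\<delta>>0. \<forall>x T. T \<ge> 0 \<and> is_sol H x {0..T} \<and> norm (x 0) < \<delta>
                      \<longrightarrow> (\<forall>t\<in>{0..T}. norm (x t) < \<epsilon>)"
proof (intro allI impI)
  fix \<epsilon> :: real assume "0 < \<epsilon>"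
  obtain r where "0 < r" "cball 0 r \<subseteq> D"
    using D_open D0 open_contains_cball by blast
  define \<epsilon>' where "\<epsilon>' = min \<epsilon> r"
  have "0 < \<epsilon>'"
    using \<open>0 < \<epsilon>\<close> \<open>0 < r\<close> by (simp add: \<epsilon>'_def)
  have "cball 0 \<epsilon>' \<subseteq> cball 0 r"
    unfolding \<epsilon>'_def by (intro subsetI) simp
  then obtain \<delta> where "0 < \<delta>" and \<delta>:
    "\<And>x T t. is_sol H x {0..T} \<Longrightarrow> norm (x 0) < \<delta> \<Longrightarrow> t \<in> {0..T} \<Longrightarrow> norm (x t) < \<epsilon>'"
    using stays_in_ball[OF \<open>0 < \<epsilon>'\<close>] \<open>cball 0 r \<subseteq> D\<close> by blast
  have "norm (x t) < \<epsilon>" if "is_sol H x {0..T}" "norm (x 0) < \<delta>" "t \<in> {0..T}" for x T t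
    using \<delta>[OF that] by (simp add: \<epsilon>'_def)
  then show "\<exists>\<delta>>0. \<forall>x T. T \<ge> 0 \<and> is_sol H x {0..T} \<and> norm (x 0) < \<delta>
                      \<longrightarrow> (\<forall>t\<in>{0..T}. norm (x t) < \<epsilon>)"
    using \<open>0 < \<delta>\<close> by blast
qed

lemma V_tendsto_zero:
  assumes sol: "is_sol H x {0..}" and in_D: "\<And>t. 0 \<le> t \<Longrightarrow> x t \<in> D"
  shows "((\<lambda>t. V (x t)) \<longlongrightarrow> 0) at_top"
proof (rule order_tendstoI)
  fix e :: real assume "0 < e"
  define T where "T = V (x 0) / \<alpha> e + 1"
  have "0 < \<alpha> e"
    using \<alpha>_pos[OF \<open>0 < e\<close>] .
  then have horizon: "V (x 0) < \<alpha> e * T"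
    by (simp add: T_def algebra_simps)
  have "0 < T"
    using \<open>0 < \<alpha> e\<close> V_nonneg[of "x 0"] by (simp add: T_def add_nonneg_pos)
  have sol_on: "is_sol H x {a..b}" if "0 \<le> a" for a b
    by (rule is_sol_subset[OF sol]) (use that in auto)
  have "V (x T) < e"
    by (rule V_below_level[OF sol_on _ \<open>0 < e\<close> horizon]) (use in_D in auto)
  show "eventually (\<lambda>t. V (x t) < e) at_top"
  proof (rule eventually_at_top_linorderI)
    fix t assume "T \<le> t"
    have "V (x t) \<le> V (x T)"
      by (rule V_antimono_along_sol[OF sol_on \<open>T \<le> t\<close>]) (use \<open>0 < T\<close> in_D in auto)
    with \<open>V (x T) < e\<close> show "V (x t) < e"
      by simp
  qed
next
  fix e :: real assume "e < 0"
  then have "e < V (x t)" for t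
    using V_nonneg[of "x t"] by simp
  then show "eventually (\<lambda>t. e < V (x t)) at_top"
    by simp
qed

lemma attractive: "\<exists>\<eta>>0. \<forall>x. is_sol H x {0..} \<and> norm (x 0) < \<eta> \<longrightarrow> (x \<longlongrightarrow> 0) at_top"
proof -
  obtain r where "0 < r" "cball 0 r \<subseteq> D"
    using D_open D0 open_contains_cball by blast
  then obtain \<eta> where "0 < \<eta>" and \<eta>:
    "\<And>x T t. is_sol H x {0..T} \<Longrightarrow> norm (x 0) < \<eta> \<Longrightarrow> t \<in> {0..T} \<Longrightarrow> norm (x t) < r"
    using stays_in_ball by blast
  have "(x \<longlongrightarrow> 0) at_top" if sol: "is_sol H x {0..}" and x0: "norm (x 0) < \<eta>" for x
  proof -
    have small: "norm (x t) \<le> r" if "0 \<le> t" for t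
    proof -
      have "is_sol H x {0..t}"
        by (rule is_sol_subset[OF sol]) auto
      then show ?thesis
        using \<eta>[of x t t] x0 that by simp
    qed
    then have "x t \<in> D" if "0 \<le> t" for t
      using \<open>cball 0 r \<subseteq> D\<close> that by auto
    then have "((\<lambda>t. V (x t)) \<longlongrightarrow> 0) at_top"
      by (rule V_tendsto_zero[OF sol])
    moreover have "eventually (\<lambda>t. norm (x t) \<le> r) at_top"
      using small by (rule eventually_at_top_linorderI)
    ultimately show ?thesis
      using tendsto_zero_of_pos_def[OF V_continuous V_pos_def] by blast
  qed
  then show ?thesis
    using \<open>0 < \<eta>\<close> by blast
qed

theorem asymp_stable: "asymp_stable H"
  unfolding asymp_stable_def using stable attractive by blast

end

lemma weak_duality:
  fixes A :: "real^'n^'k" and lam b :: "real^'k"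
  assumes "\<forall>i. 0 \<le> lam $ i" "\<forall>i. (A *v th) $ i \<le> b $ i"
  shows "(lam v* A) \<bullet> th \<le> b \<bullet> lam"
proof -
  have "(lam v* A) \<bullet> th = lam \<bullet> (A *v th)"
    by (rule dot_lmul_matrix)
  also have "\<dots> \<le> lam \<bullet> b"
    unfolding inner_vec_def by (rule sum_mono) (simp add: assms mult_left_mono)
  finally show ?thesis
    by (simp add: inner_commute)
qed

theorem theorem2:
  fixes f :: "real^'n \<Rightarrow> real^'n"
    and g :: "real^'n \<Rightarrow> real^'m^'n"
    and F :: "real^'n \<Rightarrow> real^'p^'n"
    and G :: "real^'n \<Rightarrow> real^'m^'n"
    and U :: "(real^'m) set"
    and \<theta>lo \<theta>hi :: "real^('p + 'm)"
    and A :: "real^('p + 'm)^'k" and b :: "real^'k"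
    and V :: "real^'n \<Rightarrow> real" and dV :: "real^'n \<Rightarrow> real^'n"
    and D :: "(real^'n) set"
    and \<gamma> :: "real \<Rightarrow> real"
    and k :: "real^'n \<Rightarrow> real^'m"
    and \<theta> :: "real^('p + 'm)"
  assumes f_lip: "loc_lipschitz_on UNIV f"
    and g_lip: "loc_lipschitz_on UNIV g"
    and box: "\<theta>lo \<le> \<theta>hi"
    and k_card: "CARD('k) = 2 * CARD('p + 'm)"
    and Theta_rep: "{th. \<forall>i. (A *v th) $ i \<le> b $ i} = cbox \<theta>lo \<theta>hi"
    and f0: "f 0 = 0"
    and phi0: "phi F G 0 0 = 0"
    and U0: "0 \<in> U"
    and V_nonneg: "\<forall>x. V x \<ge> 0"
    and V_pd: "pos_def V"
    and V_deriv: "\<forall>x. (V has_derivative (\<lambda>h. dV x \<bullet> h)) (at x)"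
    and dV_cont: "continuous_on UNIV dV"
    and D_open: "open D" and D0: "0 \<in> D"
    and gamma_K: "class_K \<gamma>"
    and rclf: "\<forall>x\<in>D.
        (INF u\<in>U. SUP th\<in>cbox \<theta>lo \<theta>hi.
            dV x \<bullet> f x + dV x \<bullet> (g x *v u) + (dV x v* phi F G x u) \<bullet> th) \<le> - \<gamma> (V x)"
    and K_nonempty: "\<forall>x\<in>D. {u\<in>U. dV x \<bullet> f x + dV x \<bullet> (g x *v u)
            + (SUP th\<in>cbox \<theta>lo \<theta>hi. (dV x v* phi F G x u) \<bullet> th) \<le> - \<gamma> (V x)} \<noteq> {}"
    and k_qp: "\<forall>x\<in>D. k x \<in> U
        \<and> (\<exists>lam::real^'k. (\<forall>i. lam $ i \<ge> 0)
              \<and> dV x \<bullet> f x + dV x \<bullet> (g x *v k x) + b \<bullet> lam \<le> - \<gamma> (V x)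
              \<and> lam v* A = dV x v* phi F G x (k x))
        \<and> (\<forall>u\<in>U. \<forall>lam::real^'k. ((\<forall>i. lam $ i \<ge> 0)
              \<and> dV x \<bullet> f x + dV x \<bullet> (g x *v u) + b \<bullet> lam \<le> - \<gamma> (V x)
              \<and> lam v* A = dV x v* phi F G x u)
              \<longrightarrow> (1/2) * (norm (k x))\<^sup>2 \<le> (1/2) * (norm u)\<^sup>2)"
    and k_lip: "loc_lipschitz_on D k"
    and theta_in: "\<theta> \<in> cbox \<theta>lo \<theta>hi"
  shows "asymp_stable (\<lambda>x. f x + g x *v k x + phi F G x (k x) *v \<theta>)"
proof -
  \<comment> \<open>Only feasibility of \<open>k x\<close> for the QP is used: optimality and the Lipschitz and CLF
    hypotheses make \<open>k\<close> well defined and the closed loop solvable, whereas \<open>asymp_stable\<close>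
    quantifies over given solutions.\<close>
  have "\<theta> \<in> {th. \<forall>i. (A *v th) $ i \<le> b $ i}"
    using theta_in Theta_rep by simp
  then have \<theta>_feasible: "\<forall>i. (A *v \<theta>) $ i \<le> b $ i"
    by simp
  have decrease: "dV y \<bullet> (f y + g y *v k y + phi F G y (k y) *v \<theta>) \<le> - \<gamma> (V y)"
    if y: "y \<in> D" for y
  proof -
    obtain lam :: "real^'k" where lam: "\<forall>i. 0 \<le> lam $ i"
      "dV y \<bullet> f y + dV y \<bullet> (g y *v k y) + b \<bullet> lam \<le> - \<gamma> (V y)"
      "lam v* A = dV y v* phi F G y (k y)"
      using conjunct1[OF conjunct2[OF bspec[OF k_qp y]]] by blast
    have "dV y \<bullet> (phi F G y (k y) *v \<theta>) \<le> b \<bullet> lam"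
      using weak_duality[OF lam(1) \<theta>_feasible] lam(3) by (simp add: dot_lmul_matrix)
    with lam(2) show ?thesis
      by (simp add: inner_add_right)
  qed
  interpret strict_lyapunov "\<lambda>x. f x + g x *v k x + phi F G x (k x) *v \<theta>"
      V "\<lambda>y h. dV y \<bullet> h" D \<gamma>
    by unfold_locales (use V_deriv V_pd D_open D0 gamma_K decrease in simp_all)
  show ?thesis
    by (rule asymp_stable)
qed

end
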